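(* Let $\lambda\in\mathbb C$, $\ell\in\mathbb Z$ and $f\in\mathcal V^\infty_{\lambda,\ell}$. Then $\Phi_\pm(f;s)$ extend to meromorphic functions of $s\in\mathbb C$ with poles only at $s=-k$ and $s=2\lambda+k$ ($k\in\mathbb Z_{\ge0}$). The poles are of order at most $1$, and $$\operatorname{Res}_{s=-k}\Phi_\pm(f;s)=\frac{(\pm1)^k}{k!}f^{(k)}(0),\qquad \operatorname{Res}_{s=2\lambda+k}\Phi_\pm(f;s)=-(\mp1)^{-\ell/2}\frac{(\mp1)^k(f_\infty)^{(k)}(0)}{k!},$$ unless $\lambda=-\frac q2\in-\frac12\mathbb Z_{\ge0}$ and $0\le k\le q$. In that exceptional case the poles at $s=-(q-k)$ and $s=2\lambda+k$ ($0\le k\le q$) coincide and $$\operatorname{Res}_{s=-(q-k)}\Phi_\pm(f;s)=\frac{(\pm1)^{q-k}}{(q-k)!}f^{(q-k)}(0)-(\mp1)^{-\ell/2}\frac{(\mp1)^k(f_\infty)^{(k)}(0)}{k!}.$$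
   Context: Complex powers are principal values; in particular $(+1)^{-\ell/2}=1$ and $(-1)^{-\ell/2}=e^{-\pi i\ell/2}=i^{-\ell}$. For a function $f$ on $\mathbb R$, $f_\infty(x)=(\operatorname{sgn}x)^{\ell/2}|x|^{-2\lambda}f(-1/x)$ ($x\ne0$), $(\operatorname{sgn}x)^{\ell/2}=1$ for $x>0$ and $i^\ell$ for $x<0$; $\mathcal V^\infty_{\lambda,\ell}$ is the space of $C^\infty$ functions $f$ on $\mathbb R$ such that $f_\infty$ extends to a $C^\infty$ function on $\mathbb R$ (one then writes $f_\infty$ for the extension). Local zeta functions: $\Phi_\pm(f;s)=\int_0^\infty x^{s-1}f(\pm x)dx$ for $0<\operatorname{Re}s<2\operatorname{Re}\lambda$, and in general, for $\operatorname{Re}s<2\operatorname{Re}\lambda$, $\Phi_\pm(f;s)=\frac{(\mp1)^m}{s(s+1)\cdots(s+m-1)}\int_0^\infty x^{s+m-1}f^{(m)}(\pm x)dx$ with any integer $m\ge0$ such that $-m<\operatorname{Re}s$ and $-m<2\operatorname{Re}\lambda$ (the integral converges absolutely for $-m<\operatorname{Re}s<2\operatorname{Re}\lambda$ and the definition is independent of $m$); this defines $\Phi_\pm(f;s)$ as a meromorphic function on $\operatorname{Re}s<2\operatorname{Re}\lambda$. *)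

theory Defs
  imports "HOL-Complex_Analysis.Complex_Analysis"
begin

definition nderiv :: "nat \<Rightarrow> (real \<Rightarrow> complex) \<Rightarrow> real \<Rightarrow> complex" where
  "nderiv n f = ((\<lambda>g x. vector_derivative g (at x)) ^^ n) f"

definition smooth :: "(real \<Rightarrow> complex) \<Rightarrow> bool" where
  "smooth f \<longleftrightarrow> (\<forall>n x. nderiv n f differentiable (at x))"

text \<open>The function \<open>f\<^sub>\<infinity>\<close> away from the origin; its value at \<open>0\<close> is irrelevant.\<close>

definition inversion :: "complex \<Rightarrow> int \<Rightarrow> (real \<Rightarrow> complex) \<Rightarrow> real \<Rightarrow> complex" where
  "inversion lam l f x =
     (if x > 0 then 1 else \<i> powi l) * of_real \<bar>x\<bar> powr (- 2 * lam) * f (- 1 / x)"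

definition smooth_extension :: "(real \<Rightarrow> complex) \<Rightarrow> (real \<Rightarrow> complex) \<Rightarrow> bool" where
  "smooth_extension h g \<longleftrightarrow> smooth g \<and> (\<forall>x. x \<noteq> 0 \<longrightarrow> g x = h x)"

definition V_smooth :: "complex \<Rightarrow> int \<Rightarrow> (real \<Rightarrow> complex) set" where
  "V_smooth lam l = {f. smooth f \<and> (\<exists>g. smooth_extension (inversion lam l f) g)}"

text \<open>For \<open>f \<in> V_smooth lam l\<close> the smooth extension exists, and it is unique by continuity at \<open>0\<close>.\<close>

definition f_infinity :: "complex \<Rightarrow> int \<Rightarrow> (real \<Rightarrow> complex) \<Rightarrow> real \<Rightarrow> complex" where
  "f_infinity lam l f = (THE g. smooth_extension (inversion lam l f) g)"

text \<open>
  The \<open>m\<close>-th integral formula for the local zeta function \<open>\<Phi>\<^sub>\<plusminus>(f; s)\<close>, where \<open>\<sigma> = \<plusminus>1\<close>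
  is the sign. At the zeros of the denominator it takes the meaningless value \<open>0\<close>.
\<close>

definition local_zeta :: "real \<Rightarrow> nat \<Rightarrow> (real \<Rightarrow> complex) \<Rightarrow> complex \<Rightarrow> complex" where
  "local_zeta \<sigma> m f s =
     (- of_real \<sigma>) ^ m / pochhammer s m *
     (LINT x:{0<..}|lborel. of_real x powr (s + of_nat m - 1) * nderiv m f (\<sigma> * x))"

end

theory Submission
  imports Defs
begin

text \<open>
  Put \<open>h(x) = f(\<sigma>x)\<close> and \<open>k(u) = (-\<sigma>)\<^bsup>-l/2\<^esup> f\<^sub>\<infinity>(-\<sigma>u)\<close>, so that \<open>h(x) = x\<^bsup>-2\<lambda>\<^esup> k(1/x)\<close> for \<open>x > 0\<close>.
  Splitting the Mellin integral of \<open>h\<close> at \<open>x = 1\<close> and substituting \<open>x = 1/u\<close> in the tail turns it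
  into \<open>M(h; s) + M(k; 2\<lambda> - s)\<close>, where \<open>M(g; w) = \<integral>\<^sub>0\<^sup>1 x\<^bsup>w-1\<^esup> g(x) dx\<close>. Repeated integration by parts
  continues \<open>M(g; \<cdot>)\<close> meromorphically to the plane, with at most simple poles at \<open>w = -n\<close> of residue
  \<open>g\<^bsup>(n)\<^esup>(0)/n!\<close>. The reflection \<open>s \<mapsto> 2\<lambda> - s\<close> changes the sign of a residue.
\<close>

section \<open>Iterated derivatives and smooth functions\<close>

lemma nderiv_0 [simp]: "nderiv 0 f = f"
  by (simp add: nderiv_def)

lemma nderiv_Suc: "nderiv (Suc n) f = (\<lambda>x. vector_derivative (nderiv n f) (at x))"
  by (simp add: nderiv_def)

lemma nderiv_nderiv: "nderiv n (nderiv m f) = nderiv (n + m) f"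
  by (simp add: nderiv_def funpow_add)

lemma smooth_has_vector_derivative:
  assumes "smooth f"
  shows "(nderiv n f has_vector_derivative nderiv (Suc n) f x) (at x)"
  using assms by (simp add: smooth_def nderiv_Suc vector_derivative_works[symmetric])

lemma smooth_has_vector_derivative_0:
  assumes "smooth f"
  shows "(f has_vector_derivative nderiv 1 f x) (at x)"
  using smooth_has_vector_derivative[OF assms, of 0] by simp

lemma smooth_nderiv: "smooth f \<Longrightarrow> smooth (nderiv m f)"
  by (simp add: smooth_def nderiv_nderiv)

lemma smooth_imp_continuous_on: "smooth f \<Longrightarrow> continuous_on A f"
  by (meson continuous_at_imp_continuous_on has_vector_derivative_continuous
      smooth_has_vector_derivative_0)

text \<open>Higher derivatives are computed by guessing the whole sequence: one family in which each
  member is the derivative of the one before identifies \<open>nderiv\<close>, and in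
  \<open>smoothI\<close> also certifies smoothness.\<close>

lemma nderiv_eqI:
  assumes "g 0 = f" "\<And>n x. (g n has_vector_derivative g (Suc n) x) (at x)"
  shows "nderiv n f = g n"
proof (induction n)
  case (Suc n)
  then show ?case
    using assms(2)[THEN vector_derivative_at] by (simp add: nderiv_Suc)
qed (use assms(1) in simp)

lemma smoothI:
  assumes "g 0 = f" "\<And>n x. (g n has_vector_derivative g (Suc n) x) (at x)"
  shows "smooth f"
  unfolding smooth_def nderiv_eqI[of g f, OF assms]
  using assms(2) differentiableI_vector by blast

lemma
  assumes "smooth f"
  shows smooth_scale: "smooth (\<lambda>x. c * f (b * x))"
    and nderiv_scale: "nderiv n (\<lambda>x. c * f (b * x)) = (\<lambda>x. c * of_real b ^ n * nderiv n f (b * x))"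
proof -
  let ?g = "\<lambda>n x. c * of_real b ^ n * nderiv n f (b * x)"
  have d: "(?g n has_vector_derivative ?g (Suc n) x) (at x)" for n x
  proof -
    have "((\<lambda>x. b * x) has_vector_derivative b) (at x)"
      by (auto intro!: derivative_eq_intros)
    from vector_diff_chain_at[OF this smooth_has_vector_derivative[OF assms, of n]]
    have "((\<lambda>x. nderiv n f (b * x)) has_vector_derivative b *\<^sub>R nderiv (Suc n) f (b * x)) (at x)"
      by (simp add: o_def)
    from has_vector_derivative_mult_right[OF this, of "c * of_real b ^ n"] show ?thesis
      by (simp add: scaleR_conv_of_real mult_ac)
  qed
  show "smooth (\<lambda>x. c * f (b * x))"
    by (rule smoothI[of ?g]) (use d in auto)
  show "nderiv n (\<lambda>x. c * f (b * x)) = ?g n"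
    by (rule nderiv_eqI[of ?g]) (use d in auto)
qed

text \<open>Each differentiation of \<open>x * f'\<close> releases one extra \<open>f'\<close>, so
  the n-th derivative has the same shape with \<open>b\<close> lowered by n. This operator is the
  recursion step of \<open>tail_profile\<close>.\<close>

lemma smooth_euler:
  assumes "smooth f"
  shows "smooth (\<lambda>x. b * f x - of_real x * nderiv 1 f x)"
proof (rule smoothI[of "\<lambda>n x. (b - of_nat n) * nderiv n f x - of_real x * nderiv (Suc n) f x"])
  show "((\<lambda>x. (b - of_nat n) * nderiv n f x - of_real x * nderiv (Suc n) f x) has_vector_derivative
    (b - of_nat (Suc n)) * nderiv (Suc n) f x - of_real x * nderiv (Suc (Suc n)) f x) (at x)" for n x
    by (auto intro!: derivative_eq_intros smooth_has_vector_derivative[OF assms] simp: algebra_simps)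
qed simp

section \<open>The Mellin integral over the unit interval\<close>

definition mellin01 :: "(real \<Rightarrow> complex) \<Rightarrow> complex \<Rightarrow> complex" where
  "mellin01 g w = integral {0<..1} (\<lambda>x. of_real x powr (w - 1) * g x)"

lemma mellin01_absolutely_integrable:
  assumes g: "continuous_on {0..1} g" and w: "Re w > 0"
  shows "(\<lambda>x. of_real x powr (w - 1) * g x) absolutely_integrable_on {0<..1}"
proof -
  have "bounded (g ` {0..1})"
    by (intro compact_imp_bounded compact_continuous_image g) auto
  then obtain C where C: "\<And>x. x \<in> {0..1} \<Longrightarrow> norm (g x) \<le> C"
    unfolding bounded_iff by blast
  show ?thesis
  proof (rule measurable_bounded_by_integrable_imp_absolutely_integrable)
    have "continuous_on {0<..1} (\<lambda>x. of_real x powr (w - 1) * g x)"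
      by (intro continuous_intros continuous_on_subset[OF g])
        (auto simp: complex_nonpos_Reals_iff)
    then show "(\<lambda>x. of_real x powr (w - 1) * g x) \<in> borel_measurable (lebesgue_on {0<..1})"
      by (intro continuous_imp_measurable_on_sets_lebesgue) auto
    show "(\<lambda>x. C * x powr (Re w - 1)) integrable_on {0<..1}"
      using integrable_on_powr_from_0'[of "Re w - 1" 1] w by (intro integrable_on_mult_right) auto
    show "norm (of_real x powr (w - 1) * g x) \<le> C * x powr (Re w - 1)" if "x \<in> {0<..1}" for x
    proof -
      have "norm (g x) * x powr (Re w - 1) \<le> C * x powr (Re w - 1)"
        using that C[of x] by (intro mult_right_mono) auto
      then show ?thesis
        using that by (simp add: norm_mult norm_powr_real_powr mult.commute)
    qed
  qed auto
qed

lemma mellin01_has_integral: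
  assumes "continuous_on {0..1} g" "Re w > 0"
  shows "((\<lambda>x. of_real x powr (w - 1) * g x) has_integral mellin01 g w) {0<..1}"
  unfolding mellin01_def using mellin01_absolutely_integrable[OF assms]
  by (simp add: set_lebesgue_integral_eq_integral(1) integrable_integral)

lemma has_integral_Ioc_iff_Icc:
  fixes f :: "real \<Rightarrow> 'a :: euclidean_space"
  shows "(f has_integral I) {a<..b} \<longleftrightarrow> (f has_integral I) {a..b}"
  by (rule has_integral_spike_set_eq; rule negligible_subset[of "{a}"]) auto

text \<open>Integrate the derivative of \<open>x powr w * g x\<close>. For \<open>Re w > 0\<close>
  this product is continuous up to 0 and vanishes there, so only the boundary value at 1 remains;
  differentiability is asked for in the interior alone.\<close>

lemma mellin01_by_parts:
  assumes g: "smooth g" and w: "Re w > 0"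
  shows "mellin01 (nderiv 1 g) (w + 1) = g 1 - w * mellin01 g w"
proof -
  let ?G = "\<lambda>x. of_real x powr w * g x"
  have cont: "continuous_on {0..1} ?G"
    using w by (intro continuous_intros continuous_on_powr_complex smooth_imp_continuous_on g)
      (auto)
  have "((\<lambda>x. w * (of_real x powr (w - 1) * g x) + of_real x powr ((w + 1) - 1) * nderiv 1 g x)
      has_integral (?G 1 - ?G 0)) {0..1}"
  proof (rule fundamental_theorem_of_calculus_interior[OF _ cont])
    fix x :: real assume x: "x \<in> {0<..<1}"
    have "((\<lambda>z. z powr w) has_field_derivative w * of_real x powr (w - 1)) (at (of_real x))"
      using x by (auto intro!: derivative_eq_intros simp: complex_nonpos_Reals_iff)
    moreover have "((\<lambda>x. of_real x :: complex) has_vector_derivative 1) (at x)"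
      by (auto intro!: derivative_eq_intros)
    ultimately have "((\<lambda>x. of_real x powr w) has_vector_derivative w * of_real x powr (w - 1)) (at x)"
      using field_vector_diff_chain_at[of of_real 1 x "\<lambda>z. z powr w"] by (simp add: o_def)
    then show "(?G has_vector_derivative
        w * (of_real x powr (w - 1) * g x) + of_real x powr ((w + 1) - 1) * nderiv 1 g x) (at x)"
      using smooth_has_vector_derivative_0[OF g, of x]
      by (auto intro!: derivative_eq_intros simp: algebra_simps)
  qed simp
  then have "((\<lambda>x. w * (of_real x powr (w - 1) * g x) + of_real x powr ((w + 1) - 1) * nderiv 1 g x)
      has_integral g 1) {0<..1}"
    by (simp add: has_integral_Ioc_iff_Icc)
  moreover have "((\<lambda>x. w * (of_real x powr (w - 1) * g x) + of_real x powr ((w + 1) - 1) * nderiv 1 g x)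
      has_integral (w * mellin01 g w + mellin01 (nderiv 1 g) (w + 1))) {0<..1}"
    using g w by (intro has_integral_add has_integral_mult_right mellin01_has_integral
        smooth_imp_continuous_on smooth_nderiv) auto
  ultimately have "g 1 = w * mellin01 g w + mellin01 (nderiv 1 g) (w + 1)"
    by (rule has_integral_unique)
  then show ?thesis by simp
qed

text \<open>The limiting case w = 0 of integration by parts: here the value at 0 survives, and it
  becomes the residue in \<open>mellin_cont_pole\<close>.\<close>

lemma mellin01_nderiv_1: 
  assumes g: "smooth g"
  shows "mellin01 (nderiv 1 g) 1 = g 1 - g 0"
proof -
  have "((\<lambda>x. nderiv 1 g x) has_integral (g 1 - g 0)) {0<..1}"
    unfolding has_integral_Ioc_iff_Icc
    by (rule fundamental_theorem_of_calculus)
      (use smooth_has_vector_derivative_0[OF g] in \<open>auto intro: has_vector_derivative_at_within\<close>)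
  then have "((\<lambda>x. of_real x powr (1 - 1) * nderiv 1 g x) has_integral (g 1 - g 0)) {0<..1}"
    by (rule has_integral_eq[rotated]) auto
  then show ?thesis
    unfolding mellin01_def by (rule integral_unique)
qed

text \<open>Only the origin is delicate; with y = 1/x the limit there is that of -ln y / y at
  infinity.\<close>

lemma x_ln_x_continuous_on: "continuous_on {0..} (\<lambda>x::real. x * ln x)"
proof (unfold continuous_on_def, intro ballI)
  fix x :: real assume x: "x \<in> {0..}"
  show "((\<lambda>x. x * ln x) \<longlongrightarrow> x * ln x) (at x within {0..})"
  proof (cases "x = 0")
    case True
    have "((\<lambda>x::real. - (ln (inverse x) / inverse x)) \<longlongrightarrow> - 0) (at_right 0)"
      by (intro tendsto_minus filterlim_compose[OF ln_x_over_x_tendsto_0 filterlim_inverse_at_top_right])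
    moreover have "\<forall>\<^sub>F x::real in at_right 0. - (ln (inverse x) / inverse x) = x * ln x"
      by (rule eventually_at_rightI[of 0 1]) (auto simp: ln_inverse divide_inverse mult.commute)
    ultimately have "((\<lambda>x::real. x * ln x) \<longlongrightarrow> 0) (at_right 0)"
      by (simp add: filterlim_cong)
    then show ?thesis
      using True by (simp add: at_within_Ici_at_right)
  next
    case False
    with x have "isCont (\<lambda>x. x * ln x) x"
      by (intro continuous_intros) auto
    then show ?thesis
      unfolding isCont_def by (rule tendsto_within_subset) simp
  qed
qed

text \<open>
  For \<open>Re w > 2\<close> the integrand and its \<open>w\<close>-derivative extend continuously to \<open>x = 0\<close>, so the
  Leibniz rule applies; integration by parts then brings the bound down to \<open>Re w > 0\<close>.
\<close>

lemma mellin01_holomorphic_2: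
  assumes g: "continuous_on {0..1} g"
  shows "mellin01 g holomorphic_on {w. Re w > 2}"
proof -
  \<comment> \<open>The w-derivative of the integrand, with one power of x moved to the logarithm:
    for \<open>Re w > 2\<close> both \<open>x powr (w - 2)\<close> and \<open>x * ln x\<close> are
    continuous at 0.\<close>
  let ?fx = "\<lambda>w x. of_real x powr (w - 2) * (of_real (x * ln x) * g x)"
  have "(\<lambda>w. integral (cbox 0 1) (\<lambda>x. of_real x powr (w - 1) * g x)) holomorphic_on {w. Re w > 2}"
  proof (rule leibniz_rule_holomorphic[where fx = ?fx])
    fix w :: complex and x :: real
    assume w: "w \<in> {w. Re w > 2}" and "x \<in> cbox 0 1"
    \<comment> \<open>At x = 0 both sides vanish, because \<open>0 powr z = 0\<close>.\<close>
    then have "x = 0 \<or> x > 0" by auto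
    then show "((\<lambda>w. of_real x powr (w - 1) * g x) has_field_derivative ?fx w x)
        (at w within {w. Re w > 2})"
    proof
      assume x: "x > 0"
      have "of_real x powr (w - 1) = of_real x powr (w - 2) * of_real x"
        using x powr_add[of "of_real x" "w - 2" 1] by (simp add: algebra_simps)
      moreover have "((\<lambda>w. of_real x powr (w - 1) * g x) has_field_derivative
          of_real x powr (w - 1) * of_real (ln x) * g x) (at w within {w. Re w > 2})"
        using x by (auto intro!: derivative_eq_intros simp: Ln_of_real powr_def)
      ultimately show ?thesis by (simp add: mult_ac)
    qed auto
  next
    fix w :: complex
    assume w: "w \<in> {w. Re w > 2}"
    show "(\<lambda>x. of_real x powr (w - 1) * g x) integrable_on cbox 0 1"
      using mellin01_has_integral[OF g, of w] w
      by (auto simp: has_integral_Ioc_iff_Icc)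
  next
    have 1: "continuous_on {0..1} (\<lambda>x::real. x * ln x)"
      by (rule continuous_on_subset[OF x_ln_x_continuous_on]) auto
    have "continuous_on ({w. Re w > 2} \<times> {0..1})
      (\<lambda>p. of_real (snd p) powr (fst p - 2) * (of_real (snd p * ln (snd p)) * g (snd p)))"
      by (intro continuous_intros continuous_on_powr_complex
          continuous_on_compose2[OF g continuous_on_snd[OF continuous_on_id]]
          continuous_on_compose2[OF 1 continuous_on_snd[OF continuous_on_id]]) 
        (auto)
    then show "continuous_on ({w. Re w > 2} \<times> cbox 0 1) (\<lambda>(w, x). ?fx w x)"
      by (simp add: case_prod_unfold)
  qed (auto simp: convex_halfspace_Re_gt)
  then show ?thesis
  proof (rule holomorphic_transform)
    show "integral (cbox 0 1) (\<lambda>x. of_real x powr (w - 1) * g x) = mellin01 g w"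
      if "w \<in> {w. Re w > 2}" for w
      using mellin01_has_integral[OF g, of w] that
      by (simp add: has_integral_Ioc_iff_Icc integral_unique)
  qed
qed

lemma mellin01_holomorphic:
  assumes g: "smooth g"
  shows "mellin01 g holomorphic_on {w. Re w > 0}"
proof -
  have step: "mellin01 g holomorphic_on {w. Re w > a}"
    if h: "mellin01 (nderiv 1 g) holomorphic_on {w. Re w > a + 1}" and a: "a \<ge> 0" and g: "smooth g"
    for g a
  proof (rule holomorphic_transform)
    show "(\<lambda>w. (g 1 - mellin01 (nderiv 1 g) (w + 1)) / w) holomorphic_on {w. Re w > a}"
      using a by (intro holomorphic_intros holomorphic_on_compose_gen[OF _ h, unfolded o_def]) auto
    show "(g 1 - mellin01 (nderiv 1 g) (w + 1)) / w = mellin01 g w" if "w \<in> {w. Re w > a}" for w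
    proof -
      have "Re w > 0" "w \<noteq> 0" using that a by auto
      then show ?thesis using mellin01_by_parts[OF g, of w] by (simp add: field_simps)
    qed
  qed
  \<comment> \<open>The bound 2 is available for the second derivative of g; two descents, each
    lowering the bound by one, reach 0 for g itself. Every descent divides by w, which is nonzero as
    long as a is nonnegative.\<close>
  have "mellin01 (nderiv 1 (nderiv 1 g)) holomorphic_on {w. Re w > 1 + 1}"
    using mellin01_holomorphic_2 smooth_imp_continuous_on smooth_nderiv g by fastforce
  then have "mellin01 (nderiv 1 g) holomorphic_on {w. Re w > 0 + 1}"
    using step[of "nderiv 1 g" 1] smooth_nderiv g by simp
  then show ?thesis using step[of g 0] g by simp
qed

section \<open>The half-line integral, split at 1\<close>

text \<open>Under x = 1/u the weight becomes \<open>u powr (v + 1)\<close> and the Jacobian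
  contributes 1/u^2, leaving the Mellin weight \<open>u powr (v - 1)\<close>.\<close>

lemma tail_integral_inversion:
  assumes k: "continuous_on {0..1} k" and v: "Re v > 0"
  defines "G \<equiv> \<lambda>x. of_real x powr (- v - 1) * k (1 / x)"
  shows "G absolutely_integrable_on {1..}" "integral {1..} G = mellin01 k v"
proof -
  have img: "(\<lambda>u. 1 / u) ` {0<..1} = {1::real..}"
  proof safe
    fix x :: real assume "x \<ge> 1"
    then show "x \<in> (\<lambda>u. 1 / u) ` {0<..1}"
      by (intro image_eqI[of _ _ "1 / x"]) auto
  qed (auto simp: field_simps)
  have eq: "\<bar>- (1 / u\<^sup>2)\<bar> *\<^sub>R G (1 / u) = of_real u powr (v - 1) * k u" if "u \<in> {0<..1}" for u
  proof -
    have u: "u > 0" using that by auto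
    have "of_real (1 / u) powr (- v - 1) = of_real u powr (v + 1)"
      using u by (simp add: powr_def Ln_of_real ln_div flip: of_real_divide)
        (simp add: algebra_simps)
    also have "\<dots> = of_real u powr (v - 1) * of_real (u\<^sup>2)"
      using u powr_add[of "of_real u" "v - 1" 2]
      by (simp add: power2_eq_square add.commute powr_numeral del: powr_add)
    finally have "G (1 / u) = of_real u powr (v - 1) * of_real (u\<^sup>2) * k u"
      by (simp add: G_def)
    then show ?thesis using u by (simp add: scaleR_conv_of_real)
  qed
  have "(\<lambda>u. \<bar>- (1 / u\<^sup>2)\<bar> *\<^sub>R G (1 / u)) absolutely_integrable_on {0<..1} \<longleftrightarrow>
      (\<lambda>u. of_real u powr (v - 1) * k u) absolutely_integrable_on {0<..1}"
    by (rule set_integrable_cong) (use eq in auto)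
  moreover have "integral {0<..1} (\<lambda>u. \<bar>- (1 / u\<^sup>2)\<bar> *\<^sub>R G (1 / u)) = mellin01 k v"
    unfolding mellin01_def by (rule integral_cong) (use eq in auto)
  moreover have "((\<lambda>u. 1 / u) has_field_derivative - (1 / u\<^sup>2)) (at u within {0<..1})"
    if "u \<in> {0<..1}" for u :: real
    using that by (auto intro!: derivative_eq_intros simp: power2_eq_square)
  moreover have "inj_on (\<lambda>u::real. 1 / u) {0<..1}"
    by (auto simp: inj_on_def)
  ultimately have "G absolutely_integrable_on {1..} \<and> integral {1..} G = mellin01 k v"
    using has_absolute_integral_change_of_variables_real
        [of "{0<..1}" "\<lambda>u. 1 / u" "\<lambda>u. - (1 / u\<^sup>2)" G "mellin01 k v"]
      mellin01_absolutely_integrable[OF k v] unfolding img by simp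
  then show "G absolutely_integrable_on {1..}" "integral {1..} G = mellin01 k v"
    by auto
qed

text \<open>The exponent \<open>- (v + w)\<close> is the one that turns the integrand on [1,
  \<infinity>) into the form of \<open>tail_integral_inversion\<close>. Positivity of
  \<open>Re w\<close> gives convergence at 0, that of \<open>Re v\<close> convergence at
  infinity.\<close>

lemma mellin_halfline_split:
  assumes h: "continuous_on {0..} h" and k: "continuous_on {0..1} k"
    and w: "Re w > 0" and v: "Re v > 0"
    and hk: "\<And>x. x \<ge> 1 \<Longrightarrow> h x = of_real x powr (- (v + w)) * k (1 / x)"
  shows "(LINT x:{0<..}|lborel. of_real x powr (w - 1) * h x) = mellin01 h w + mellin01 k v"
proof -
  let ?f = "\<lambda>x. of_real x powr (w - 1) * h x"
  have h01: "continuous_on {0..1} h"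
    by (rule continuous_on_subset[OF h]) auto
  have tail: "?f x = of_real x powr (- v - 1) * k (1 / x)" if "x \<in> {1..}" for x
  proof -
    have "of_real x powr (w - 1) * of_real x powr (- (v + w)) = of_real x powr (- v - 1)"
      by (subst powr_add[symmetric], rule arg_cong[where f = "(powr) _"]) simp
    then show ?thesis
      using that hk[of x] by (simp add: mult.assoc[symmetric])
  qed
  have i1: "?f absolutely_integrable_on {0<..1}"
    by (rule mellin01_absolutely_integrable[OF h01 w])
  have i2: "?f absolutely_integrable_on {1..}" "integral {1..} ?f = mellin01 k v"
    using tail_integral_inversion[OF k v] set_integrable_cong[of lebesgue lebesgue "{1..}" "{1..}" ?f]
      integral_cong[of "{1..}" ?f] tail by auto
  have un: "{0<..1} \<union> {1..} = {0::real<..}" by auto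
  have i: "?f absolutely_integrable_on {0<..}"
    using set_integrable_Un[OF i1 i2(1)] unfolding un by simp
  have "(?f has_integral (mellin01 h w + mellin01 k v)) ({0<..1} \<union> {1..})"
  proof (rule has_integral_Un)
    show "(?f has_integral mellin01 h w) {0<..1}"
      by (rule mellin01_has_integral[OF h01 w])
    show "(?f has_integral mellin01 k v) {1..}"
      using i2 by (metis set_lebesgue_integral_eq_integral(1) integrable_integral)
    show "negligible ({0<..1} \<inter> {1::real..})"
      by (rule negligible_subset[of "{1}"]) auto
  qed
  then have "(LINT x:{0<..}|lebesgue. ?f x) = mellin01 h w + mellin01 k v"
    using i unfolding un by (simp add: set_lebesgue_integral_eq_integral(2) integral_unique)
  \<comment> \<open>The integral so far is over the completed measure, whereas
    \<open>local_zeta\<close> uses \<open>lborel\<close>; the two agree for Borel measurable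
    integrands.\<close>
  moreover have "(\<lambda>x. indicator {0<..} x *\<^sub>R ?f x) \<in> borel_measurable lborel"
  proof -
    have "continuous_on {0<..} ?f"
      by (intro continuous_intros continuous_on_subset[OF h])
        (auto simp: complex_nonpos_Reals_iff)
    from borel_measurable_continuous_on_indicator[OF _ this] show ?thesis
      by simp
  qed
  then have "(LINT x:{0<..}|lebesgue. ?f x) = (LINT x:{0<..}|lborel. ?f x)"
    unfolding set_lebesgue_integral_def by (rule integral_completion)
  ultimately show ?thesis by simp
qed

section \<open>Derivatives of the tail\<close>

text \<open>
  If \<open>h(x) = x\<^bsup>-a\<^esup> k(1/x)\<close>, then \<open>h\<^bsup>(m)\<^esup>(x) = x\<^bsup>-a-m\<^esup> k\<^sub>m(1/x)\<close> with the profiles \<open>k\<^sub>m\<close> below.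
\<close>

primrec tail_profile :: "complex \<Rightarrow> (real \<Rightarrow> complex) \<Rightarrow> nat \<Rightarrow> real \<Rightarrow> complex" where
  "tail_profile a k 0 = k"
| "tail_profile a k (Suc m) =
     (\<lambda>u. - (a + of_nat m) * tail_profile a k m u - of_real u * nderiv 1 (tail_profile a k m) u)"

lemma smooth_tail_profile: "smooth k \<Longrightarrow> smooth (tail_profile a k m)"
  by (induction m) (simp_all only: tail_profile.simps smooth_euler)

text \<open>Differentiating \<open>x powr (- b) * p (1 / x)\<close> gives
  \<open>x powr (- b - 1)\<close> times -b p(u) - u p'(u) at u = 1/x, which is the recursion for the
  profiles with b = a + m.\<close>

lemma nderiv_eq_tail_profile:
  assumes h: "smooth h" and k: "smooth k"
    and hk: "\<And>x. x > 0 \<Longrightarrow> h x = of_real x powr (- a) * k (1 / x)"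
    and x: "x > 0"
  shows "nderiv m h x = of_real x powr (- (a + of_nat m)) * tail_profile a k m (1 / x)"
  using x
proof (induction m arbitrary: x)
  case (Suc m)
  let ?p = "tail_profile a k m" and ?b = "a + of_nat m"
  have "((\<lambda>z. z powr (- ?b)) has_field_derivative (- ?b) * of_real x powr (- ?b - 1)) (at (of_real x))"
    using Suc.prems by (auto intro!: derivative_eq_intros simp: complex_nonpos_Reals_iff)
  moreover have "((\<lambda>x. of_real x :: complex) has_vector_derivative 1) (at x)"
    by (auto intro!: derivative_eq_intros)
  ultimately have 1: "((\<lambda>x. of_real x powr (- ?b)) has_vector_derivative
      (- ?b) * of_real x powr (- ?b - 1)) (at x)"
    using field_vector_diff_chain_at[of of_real 1 x "\<lambda>z. z powr (- ?b)"] by (simp add: o_def)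
  have "((\<lambda>x. 1 / x) has_vector_derivative - (1 / x\<^sup>2)) (at x)"
    using Suc.prems unfolding has_real_derivative_iff_has_vector_derivative[symmetric]
    by (auto intro!: derivative_eq_intros simp: power2_eq_square)
  from vector_diff_chain_at[OF this smooth_has_vector_derivative_0[OF smooth_tail_profile[OF k]]]
  have 2: "((\<lambda>x. ?p (1 / x)) has_vector_derivative - (1 / x\<^sup>2) *\<^sub>R nderiv 1 ?p (1 / x)) (at x)"
    by (simp add: o_def)
  have "((\<lambda>x. of_real x powr (- ?b) * ?p (1 / x)) has_vector_derivative
     of_real x powr (- ?b) * (- (1 / x\<^sup>2) *\<^sub>R nderiv 1 ?p (1 / x))
     + (- ?b) * of_real x powr (- ?b - 1) * ?p (1 / x)) (at x)"
    by (rule has_vector_derivative_mult[OF 1 2])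
  also have "of_real x powr (- ?b) = of_real x powr (- ?b - 1) * of_real x"
    using Suc.prems powr_add[of "of_real x" "- ?b - 1" 1] by simp
  also have "\<dots> * (- (1 / x\<^sup>2) *\<^sub>R nderiv 1 ?p (1 / x)) + (- ?b) * of_real x powr (- ?b - 1) * ?p (1 / x)
     = of_real x powr (- (a + of_nat (Suc m))) * tail_profile a k (Suc m) (1 / x)"
  proof -
    have "q * of_real x * (- (1 / x\<^sup>2) *\<^sub>R n) + (- b) * q * p = q * (- b * p - of_real (1 / x) * n)"
      for q b p n :: complex
      using Suc.prems by (simp add: scaleR_conv_of_real field_simps power2_eq_square)
    moreover have "- (a + of_nat (Suc m)) = - ?b - 1" by simp
    ultimately show ?thesis
      by (simp only: tail_profile.simps)
  qed
  finally have "((\<lambda>x. of_real x powr (- ?b) * ?p (1 / x)) has_vector_derivative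
     of_real x powr (- (a + of_nat (Suc m))) * tail_profile a k (Suc m) (1 / x)) (at x)" .
  \<comment> \<open>The induction hypothesis is an identity on positive arguments only, so the
    derivative is transferred within the open half-line.\<close>
  then have "(nderiv m h has_vector_derivative
     of_real x powr (- (a + of_nat (Suc m))) * tail_profile a k (Suc m) (1 / x)) (at x)"
    by (rule has_vector_derivative_transform_within_open[of _ _ _ "{0<..}"])
      (use Suc in auto)
  then show ?case
    by (simp add: nderiv_Suc vector_derivative_at)
qed (use hk in simp)

text \<open>Integrating the u p' term by parts adds a - s to the coefficient -(a + m). The result
  -(s + m) does not contain a and is, up to sign, the next factor of
  \<open>pochhammer s\<close>.\<close>

lemma mellin01_tail_profile_Suc:
  assumes k: "smooth k" and s: "Re s < Re a"
  shows "mellin01 (tail_profile a k (Suc m)) (a - s) =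
    - tail_profile a k m 1 - (s + of_nat m) * mellin01 (tail_profile a k m) (a - s)"
proof -
  let ?p = "tail_profile a k m" and ?v = "a - s"
  have p: "smooth ?p" by (rule smooth_tail_profile[OF k])
  have v: "Re ?v > 0" using s by simp
  have "((\<lambda>x. - (a + of_nat m) * (of_real x powr (?v - 1) * ?p x) -
          of_real x powr (?v + 1 - 1) * nderiv 1 ?p x) has_integral
      - (a + of_nat m) * mellin01 ?p ?v - mellin01 (nderiv 1 ?p) (?v + 1)) {0<..1}"
    using v by (intro has_integral_diff has_integral_mult_right mellin01_has_integral
        smooth_imp_continuous_on smooth_nderiv p) auto
  then have "((\<lambda>x. of_real x powr (?v - 1) * tail_profile a k (Suc m) x) has_integral
      - (a + of_nat m) * mellin01 ?p ?v - mellin01 (nderiv 1 ?p) (?v + 1)) {0<..1}"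
  proof (rule has_integral_eq[rotated])
    fix x :: real assume x: "x \<in> {0<..1}"
    have "of_real x powr (?v + 1 - 1) = of_real x powr (?v - 1) * of_real x"
      using x powr_add[of "of_real x" "?v - 1" 1] by simp
    then show "- (a + of_nat m) * (of_real x powr (?v - 1) * ?p x) -
          of_real x powr (?v + 1 - 1) * nderiv 1 ?p x =
        of_real x powr (?v - 1) * tail_profile a k (Suc m) x"
      by (simp only: tail_profile.simps) (simp only: algebra_simps)
  qed
  then have eq: "mellin01 (tail_profile a k (Suc m)) ?v =
      - (a + of_nat m) * mellin01 ?p ?v - mellin01 (nderiv 1 ?p) (?v + 1)"
    unfolding mellin01_def[of "tail_profile a k (Suc m)"] by (rule integral_unique)
  show ?thesis
    unfolding eq mellin01_by_parts[OF p v] by (simp add: algebra_simps)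
qed

section \<open>Continuation by repeated integration by parts\<close>

text \<open>
  The boundary terms at \<open>x = 1\<close> of \<open>m\<close> integrations by parts. They enter the integrals over
  \<open>(0,1]\<close> and over \<open>[1,\<infinity>)\<close> with opposite signs and cancel in the sum.
\<close>

definition mellin_boundary :: "(real \<Rightarrow> complex) \<Rightarrow> nat \<Rightarrow> complex \<Rightarrow> complex" where
  "mellin_boundary h m s = (\<Sum>j<m. (- 1) ^ j * nderiv j h 1 / pochhammer s (Suc j))"

text \<open>The result of m integrations by parts in \<open>mellin01 h s\<close>. It makes sense for
  \<open>Re s > - m\<close> away from the zeros of the Pochhammer symbols.\<close>

definition mellin_step :: "nat \<Rightarrow> (real \<Rightarrow> complex) \<Rightarrow> complex \<Rightarrow> complex" where
  "mellin_step m h s =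
     mellin_boundary h m s + (- 1) ^ m / pochhammer s m * mellin01 (nderiv m h) (s + of_nat m)"

text \<open>The number of steps is chosen pointwise; the added 1 makes \<open>Re s > - m\<close>
  strict when \<open>Re s\<close> is a nonpositive integer.\<close>

definition mellin_cont :: "(real \<Rightarrow> complex) \<Rightarrow> complex \<Rightarrow> complex" where
  "mellin_cont h s = mellin_step (nat \<lceil>- Re s\<rceil> + 1) h s"

lemma nonpos_Int_iff_nat: "(s::complex) \<in> \<int>\<^sub>\<le>\<^sub>0 \<longleftrightarrow> (\<exists>k::nat. s = - of_nat k)"
  by (auto elim!: nonpos_Ints_cases')

lemma pochhammer_ne_0:
  fixes s :: complex
  assumes "s \<notin> \<int>\<^sub>\<le>\<^sub>0"
  shows "pochhammer s m \<noteq> 0"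
  using assms by (auto simp: pochhammer_eq_0_iff nonpos_Int_iff_nat)

text \<open>The algebra of one integration by parts, with P = \<open>pochhammer s m\<close>, d = s +
  m, e = (-1)^m and boundary value b. It serves both the unit interval and the tail.\<close>

lemma by_parts_identity:
  fixes P d :: complex
  assumes "P \<noteq> 0" "d \<noteq> 0"
  shows "- e / (P * d) * (b - d * J) = e / P * J - e * b / (P * d)"
  using assms by (simp add: field_simps)

lemma mellin_step_Suc:
  assumes h: "smooth h" and s: "s \<notin> \<int>\<^sub>\<le>\<^sub>0" "Re s > - real m"
  shows "mellin_step (Suc m) h s = mellin_step m h s"
proof -
  have nz: "pochhammer s m \<noteq> 0" "s + of_nat m \<noteq> 0"
    using pochhammer_ne_0[OF s(1), of "Suc m"] by (auto simp: pochhammer_Suc)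
  have "nderiv (Suc m) h = nderiv 1 (nderiv m h)"
    by (simp add: nderiv_nderiv)
  moreover have "s + of_nat (Suc m) = s + of_nat m + 1"
    by simp
  ultimately have "mellin01 (nderiv (Suc m) h) (s + of_nat (Suc m)) =
      nderiv m h 1 - (s + of_nat m) * mellin01 (nderiv m h) (s + of_nat m)"
    using mellin01_by_parts[OF smooth_nderiv[OF h], of "s + of_nat m" m] s by (simp add: algebra_simps)
  then show ?thesis
    using by_parts_identity[OF nz, of "(- 1) ^ m" "nderiv m h 1"]
    by (simp add: mellin_step_def mellin_boundary_def pochhammer_Suc)
qed

lemma mellin_step_independent:
  assumes h: "smooth h" and s: "s \<notin> \<int>\<^sub>\<le>\<^sub>0" "Re s > - real m" "Re s > - real n"
  shows "mellin_step m h s = mellin_step n h s"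
proof -
  have "mellin_step n h s = mellin_step m h s" if "m \<le> n" "Re s > - real m" for m n
    using that
  proof (induction n rule: dec_induct)
    case (step n)
    then show ?case using mellin_step_Suc[OF h s(1), of n] by simp
  qed simp
  then show ?thesis using s by (metis linear)
qed

lemma mellin_cont_eq_step:
  assumes h: "smooth h" and s: "s \<notin> \<int>\<^sub>\<le>\<^sub>0" "Re s > - real m"
  shows "mellin_cont h s = mellin_step m h s"
  unfolding mellin_cont_def by (intro mellin_step_independent assms) linarith

lemma mellin_cont_eq_mellin01:
  assumes h: "smooth h" and s: "Re s > 0"
  shows "mellin_cont h s = mellin01 h s"
proof -
  have "s \<notin> \<int>\<^sub>\<le>\<^sub>0" using s by (auto elim!: nonpos_Ints_cases')
  then show ?thesis
    using mellin_cont_eq_step[OF h, of s 0] s by (simp add: mellin_step_def mellin_boundary_def)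
qed

text \<open>Iterates \<open>mellin01_tail_profile_Suc\<close>. Since derivatives of h and profiles
  agree at 1, the accumulated boundary terms are exactly those of h.\<close>

lemma mellin_tail:
  assumes k: "smooth k" and s: "Re s < Re a" "s \<notin> \<int>\<^sub>\<le>\<^sub>0"
    and hk: "\<And>j. nderiv j h 1 = tail_profile a k j 1"
  shows "(- 1) ^ m / pochhammer s m * mellin01 (tail_profile a k m) (a - s) =
    mellin01 k (a - s) + mellin_boundary h m s"
proof (induction m)
  case (Suc m)
  have nz: "pochhammer s m \<noteq> 0" "s + of_nat m \<noteq> 0"
    using pochhammer_ne_0[OF s(2), of "Suc m"] by (auto simp: pochhammer_Suc)
  have "(- 1) ^ Suc m / pochhammer s (Suc m) * mellin01 (tail_profile a k (Suc m)) (a - s) =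
    (- 1) ^ m / pochhammer s m * mellin01 (tail_profile a k m) (a - s)
      + (- 1) ^ m * nderiv m h 1 / pochhammer s (Suc m)"
    unfolding mellin01_tail_profile_Suc[OF k s(1)] hk
    using by_parts_identity[OF nz, of "(- 1) ^ m" "- tail_profile a k m 1"]
    by (simp add: pochhammer_Suc)
  then show ?case unfolding Suc by (simp add: mellin_boundary_def)
qed (simp add: mellin_boundary_def)

text \<open>After the split at 1, the unit interval contributes \<open>mellin_step m h s\<close>
  minus the boundary sum and the tail contributes \<open>mellin01 k (a - s)\<close> plus the same
  sum. As \<open>Re (a - s) > 0\<close>, the latter integral is already
  \<open>mellin_cont k (a - s)\<close>.\<close>

lemma mellin_halfline_eq_cont:
  assumes h: "smooth h" and k: "smooth k"
    and hk: "\<And>x. x > 0 \<Longrightarrow> h x = of_real x powr (- a) * k (1 / x)"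
    and s: "Re s < Re a" "- real m < Re s" "s \<notin> \<int>\<^sub>\<le>\<^sub>0"
  shows "(- 1) ^ m / pochhammer s m *
      (LINT x:{0<..}|lborel. of_real x powr (s + of_nat m - 1) * nderiv m h x) =
    mellin_cont h s + mellin_cont k (a - s)"
proof -
  have hk': "nderiv m h x = of_real x powr (- (a + of_nat m)) * tail_profile a k m (1 / x)"
    if "x > 0" for x m
    by (rule nderiv_eq_tail_profile[OF h k hk that])
  have "(LINT x:{0<..}|lborel. of_real x powr (s + of_nat m - 1) * nderiv m h x) =
      mellin01 (nderiv m h) (s + of_nat m) + mellin01 (tail_profile a k m) (a - s)"
  proof (rule mellin_halfline_split)
    show "nderiv m h x = of_real x powr (- (a - s + (s + of_nat m))) * tail_profile a k m (1 / x)"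
      if "x \<ge> 1" for x
      using hk'[of x m] that by simp
  qed (use s in \<open>auto intro!: smooth_imp_continuous_on smooth_nderiv smooth_tail_profile h k\<close>)
  then have "(- 1) ^ m / pochhammer s m *
      (LINT x:{0<..}|lborel. of_real x powr (s + of_nat m - 1) * nderiv m h x) =
    (- 1) ^ m / pochhammer s m * mellin01 (nderiv m h) (s + of_nat m) +
    (- 1) ^ m / pochhammer s m * mellin01 (tail_profile a k m) (a - s)"
    by (simp add: ring_distribs)
  also have "(- 1) ^ m / pochhammer s m * mellin01 (tail_profile a k m) (a - s) =
      mellin01 k (a - s) + mellin_boundary h m s"
    by (rule mellin_tail[OF k s(1,3)]) (use hk'[of 1] in simp)
  also have "mellin01 k (a - s) = mellin_cont k (a - s)"
    using mellin_cont_eq_mellin01[OF k, of "a - s"] s by simp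
  finally show ?thesis
    using mellin_cont_eq_step[OF h s(3,2)] by (simp add: mellin_step_def)
qed

section \<open>Simple poles and residues\<close>

text \<open>Allowing r = 0 treats regular points and poles alike, so the coefficients add even where
  poles of two summands coincide, as in the exceptional case.\<close>

definition at_most_simple_pole :: "(complex \<Rightarrow> complex) \<Rightarrow> complex \<Rightarrow> complex \<Rightarrow> bool" where
  "at_most_simple_pole F z r \<longleftrightarrow>
     (\<exists>H. H analytic_on {z} \<and> H z = r \<and> (\<forall>\<^sub>F s in at z. F s = H s / (s - z)))"

lemma at_most_simple_pole_analytic:
  assumes "F analytic_on {z}"
  shows "at_most_simple_pole F z 0"
  unfolding at_most_simple_pole_def
proof (intro exI[of _ "\<lambda>s. (s - z) * F s"] conjI)
  show "\<forall>\<^sub>F s in at z. F s = (s - z) * F s / (s - z)"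
    by (auto simp: eventually_at_filter)
qed (use assms in \<open>auto intro!: analytic_intros\<close>)

lemma at_most_simple_pole_add:
  assumes "at_most_simple_pole F z r" "at_most_simple_pole G z q"
  shows "at_most_simple_pole (\<lambda>s. F s + G s) z (r + q)"
proof -
  obtain H K where H: "H analytic_on {z}" "H z = r" "\<forall>\<^sub>F s in at z. F s = H s / (s - z)"
    and K: "K analytic_on {z}" "K z = q" "\<forall>\<^sub>F s in at z. G s = K s / (s - z)"
    using assms unfolding at_most_simple_pole_def by auto
  show ?thesis
    unfolding at_most_simple_pole_def
  proof (intro exI[of _ "\<lambda>s. H s + K s"] conjI)
    show "\<forall>\<^sub>F s in at z. F s + G s = (H s + K s) / (s - z)"
      using H(3) K(3) by eventually_elim (simp add: add_divide_distrib)
  qed (use H K in \<open>auto intro!: analytic_intros\<close>)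
qed

lemma filterlim_reflect_at: "filterlim (\<lambda>s::complex. a - s) (at (a - z)) (at z)"
proof (rule filterlim_atI)
  show "((\<lambda>s. a - s) \<longlongrightarrow> a - z) (at z)"
    by (intro tendsto_intros)
qed (auto simp: eventually_at_filter)

text \<open>The reflection replaces the denominator s - z by its negative; this is the source of the
  minus sign in the residues at 2\<lambda> + k.\<close>

lemma at_most_simple_pole_reflect:
  assumes "at_most_simple_pole F (a - z) r"
  shows "at_most_simple_pole (\<lambda>s. F (a - s)) z (- r)"
proof -
  obtain H where H: "H analytic_on {a - z}" "H (a - z) = r"
      "\<forall>\<^sub>F s in at (a - z). F s = H s / (s - (a - z))"
    using assms unfolding at_most_simple_pole_def by auto
  show ?thesis
    unfolding at_most_simple_pole_def
  proof (intro exI[of _ "\<lambda>s. - H (a - s)"] conjI)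
    show "\<forall>\<^sub>F s in at z. F (a - s) = - H (a - s) / (s - z)"
      using eventually_compose_filterlim[OF H(3) filterlim_reflect_at]
    proof (rule eventually_mono)
      fix s assume "F (a - s) = H (a - s) / (a - s - (a - z))"
      moreover have "a - s - (a - z) = - (s - z)" by simp
      ultimately show "F (a - s) = - H (a - s) / (s - z)" by (simp del: minus_diff_eq)
    qed
    have "(H \<circ> (\<lambda>s. a - s)) analytic_on {z}"
      by (rule analytic_on_compose) (use H(1) in \<open>auto intro!: analytic_intros\<close>)
    then show "(\<lambda>s. - H (a - s)) analytic_on {z}"
      by (auto intro!: analytic_intros simp: o_def)
  qed (use H in auto)
qed

lemma at_most_simple_pole_imp:
  assumes "at_most_simple_pole F z r"
  shows at_most_simple_pole_meromorphic: "F meromorphic_on {z}"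
    and at_most_simple_pole_residue: "residue F z = r"
    and at_most_simple_pole_zorder: "is_pole F z \<Longrightarrow> zorder F z = - 1"
proof -
  obtain H where H: "H analytic_on {z}" "H z = r" and ev: "\<forall>\<^sub>F s in at z. F s = H s / (s - z)"
    using assms unfolding at_most_simple_pole_def by auto
  have "(\<lambda>s. H s / (s - z)) meromorphic_on {z}"
    by (intro meromorphic_intros analytic_on_imp_meromorphic_on H)
  then show "F meromorphic_on {z}"
    using meromorphic_on_cong[of "{z}" F "\<lambda>s. H s / (s - z)" "{z}"] ev by simp
  obtain U where U: "open U" "z \<in> U" "H holomorphic_on U"
    using H(1) by (auto simp: analytic_at)
  have "residue F z = residue (\<lambda>s. H s / (s - z)) z"
    by (rule residue_cong[OF ev refl])
  also have "\<dots> = r"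
    using residue_simple[OF U] H by simp
  finally show "residue F z = r" .
  assume pole: "is_pole F z"
  \<comment> \<open>If H vanished at z, the quotient H(s)/(s - z) would tend to H'(z), so F would
    have a finite limit at its pole.\<close>
  have "r \<noteq> 0"
  proof
    assume "r = 0"
    have "(H has_field_derivative deriv H z) (at z)"
      using U holomorphic_derivI by blast
    then have "((\<lambda>s. H s / (s - z)) \<longlongrightarrow> deriv H z) (at z)"
      using H \<open>r = 0\<close> by (simp add: has_field_derivative_iff)
    then have "(F \<longlongrightarrow> deriv H z) (at z)"
      using ev by (simp add: filterlim_cong)
    then show False
      using pole unfolding is_pole_def
      by (meson at_neq_bot not_tendsto_and_filterlim_at_infinity)
  qed
  obtain V where V: "open V" "z \<in> V" "\<And>s. s \<in> V \<Longrightarrow> s \<noteq> z \<Longrightarrow> F s = H s / (s - z)"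
    using ev unfolding eventually_at_topological by auto
  show "zorder F z = - 1"
  proof (rule zorder_eqI[of "U \<inter> V" _ H])
    show "F w = H w * (w - z) powi - 1" if "w \<in> U \<inter> V" "w \<noteq> z" for w
      using V(3)[of w] that by (simp add: power_int_minus divide_inverse)
  qed (use U V H \<open>r \<noteq> 0\<close> in \<open>auto intro: holomorphic_on_subset\<close>)
qed

section \<open>Analyticity and poles of the continued integral\<close>

lemma mellin01_nderiv_analytic:
  assumes "smooth h" "Re z > - real m"
  shows "(\<lambda>s. mellin01 (nderiv m h) (s + of_nat m)) analytic_on {z}"
proof -
  have "mellin01 (nderiv m h) analytic_on {w. Re w > 0}"
    using mellin01_holomorphic[OF smooth_nderiv[OF assms(1)]]
    by (simp add: analytic_on_open open_halfspace_Re_gt)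
  then have "(mellin01 (nderiv m h) \<circ> (\<lambda>s. s + of_nat m)) analytic_on {z}"
    by (intro analytic_on_compose analytic_intros) (use assms in \<open>auto elim: analytic_on_subset\<close>)
  then show ?thesis by (simp add: o_def)
qed

lemma analytic_on_pochhammer [analytic_intros]:
  "f analytic_on A \<Longrightarrow> (\<lambda>s. pochhammer (f s) m) analytic_on A"
  by (induction m) (auto simp: pochhammer_Suc intro!: analytic_intros)

text \<open>Near a given point one fixed m replaces the pointwise choice in
  \<open>mellin_cont\<close>, so analyticity can be read off a single formula.\<close>

lemma eventually_nhds_mellin_cont_eq_step:
  assumes h: "smooth h" and z: "Re z > - real m"
  shows "\<forall>\<^sub>F s in nhds z. s \<notin> \<int>\<^sub>\<le>\<^sub>0 \<longrightarrow> mellin_cont h s = mellin_step m h s"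
proof -
  have "\<forall>\<^sub>F s in nhds z. s \<in> {s. Re s > - real m}"
    by (rule eventually_nhds_in_open) (use z in \<open>auto simp: open_halfspace_Re_gt\<close>)
  then show ?thesis
    by eventually_elim (use mellin_cont_eq_step[OF h] in auto)
qed

lemma mellin_cont_analytic:
  assumes h: "smooth h" and z: "z \<notin> \<int>\<^sub>\<le>\<^sub>0"
  shows "mellin_cont h analytic_on {z}"
proof -
  obtain m :: nat where m: "real m > - Re z"
    using reals_Archimedean2 by blast
  have "mellin_step m h analytic_on {z}"
    unfolding mellin_step_def[abs_def] mellin_boundary_def using pochhammer_ne_0[OF z] m
    by (auto intro!: analytic_intros mellin01_nderiv_analytic h)
  moreover have "\<forall>\<^sub>F s in nhds z. mellin_cont h s = mellin_step m h s"
  proof -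
    have "\<forall>\<^sub>F s in nhds z. s \<in> - \<int>\<^sub>\<le>\<^sub>0"
      by (rule eventually_nhds_in_open) (use z in \<open>auto simp: open_Compl\<close>)
    moreover have "\<forall>\<^sub>F s in nhds z. s \<notin> \<int>\<^sub>\<le>\<^sub>0 \<longrightarrow> mellin_cont h s = mellin_step m h s"
      by (rule eventually_nhds_mellin_cont_eq_step[OF h]) (use m in simp)
    ultimately show ?thesis by eventually_elim auto
  qed
  ultimately show ?thesis
    using analytic_at_cong[OF _ refl] by blast
qed

text \<open>With m = k + 1 steps, s + k is the only factor of the denominators that vanishes at
  -k.\<close>

lemma mellin_cont_pole:
  assumes h: "smooth h"
  shows "at_most_simple_pole (mellin_cont h) (- of_nat k) (nderiv k h 0 / fact k)"
proof -
  \<comment> \<open>This is (s + k) times \<open>mellin_step (Suc k) h s\<close>, with the last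
    boundary term merged into the integral term. At s = -k the first summand drops out and
    \<open>pochhammer (- k) k\<close> equals (-1)^k k!.\<close>
  define H where "H = (\<lambda>s. (s + of_nat k) * mellin_boundary h k s +
     (- 1) ^ k * (nderiv k h 1 - mellin01 (nderiv (Suc k) h) (s + of_nat (Suc k))) / pochhammer s k)"
  have nz: "pochhammer (- of_nat k :: complex) j \<noteq> 0" if "j \<le> k" for j
    using that by (auto simp: pochhammer_eq_0_iff)
  show ?thesis
    unfolding at_most_simple_pole_def
  proof (intro exI[of _ H] conjI)
    show "H analytic_on {- of_nat k}"
      unfolding H_def mellin_boundary_def
      by (intro analytic_intros mellin01_nderiv_analytic h ballI) (use nz in auto)
    have "nderiv (Suc k) h = nderiv 1 (nderiv k h)"
      by (simp add: nderiv_nderiv)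
    then have "mellin01 (nderiv (Suc k) h) 1 = nderiv k h 1 - nderiv k h 0"
      using mellin01_nderiv_1[OF smooth_nderiv[OF h, of k]] by simp
    then show "H (- of_nat k) = nderiv k h 0 / fact k"
      by (simp add: H_def pochhammer_same)
    have "\<forall>\<^sub>F s in at (- of_nat k). s \<notin> \<int>\<^sub>\<le>\<^sub>0 \<longrightarrow> mellin_cont h s = mellin_step (Suc k) h s"
      using eventually_nhds_mellin_cont_eq_step[OF h, of "Suc k" "- of_nat k"]
      by (auto simp: eventually_at_filter elim: eventually_mono)
    moreover have "\<forall>\<^sub>F s in at (- of_nat k :: complex). s \<notin> \<int>\<^sub>\<le>\<^sub>0"
    \<comment> \<open>Distinct integers are at distance at least 1, so the punctured unit disc
      around -k contains no nonpositive integer.\<close>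
    proof (unfold eventually_at, intro exI[of _ 1] conjI ballI impI)
      fix s :: complex
      assume s: "s \<noteq> - of_nat k \<and> dist s (- of_nat k) < 1"
      show "s \<notin> \<int>\<^sub>\<le>\<^sub>0"
      proof
        assume "s \<in> \<int>\<^sub>\<le>\<^sub>0"
        then obtain j :: nat where j: "s = - of_nat j" by (auto simp: nonpos_Int_iff_nat)
        have "s - - of_nat k = of_int (int k - int j)" by (simp add: j)
        then have "dist s (- of_nat k) = \<bar>real_of_int (int k - int j)\<bar>"
          unfolding dist_norm by (simp only: norm_of_int)
        then show False using s j by auto
      qed
    qed simp
    ultimately show "\<forall>\<^sub>F s in at (- of_nat k). mellin_cont h s = H s / (s - - of_nat k)"
    proof eventually_elim
      case (elim s)
      have "pochhammer s k \<noteq> 0" "s + of_nat k \<noteq> 0"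
        using pochhammer_ne_0[OF elim(2), of "Suc k"] by (auto simp: pochhammer_Suc)
      then show ?case
        using elim
        by (simp add: mellin_step_def H_def mellin_boundary_def pochhammer_Suc divide_simps)
          (simp add: algebra_simps)
    qed
  qed
qed

section \<open>The function at infinity and the sign factors\<close>

lemma f_infinity_eqI:
  assumes "smooth_extension (inversion lam l f) g"
  shows "f_infinity lam l f = g"
  unfolding f_infinity_def
proof (rule the_equality)
  show "smooth_extension (inversion lam l f) g" by fact
next
  fix g' assume g': "smooth_extension (inversion lam l f) g'"
  have cont: "(k \<longlongrightarrow> k 0) (at 0)" if "smooth k" for k
    using smooth_imp_continuous_on[OF that, of UNIV]
    by (auto simp: continuous_on_eq_continuous_at isCont_def)
  have "(g' \<longlongrightarrow> g 0) (at 0)"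
  proof (rule Lim_transform_eventually)
    show "(g \<longlongrightarrow> g 0) (at 0)"
      using assms by (intro cont) (simp add: smooth_extension_def)
    show "\<forall>\<^sub>F x in at 0. g x = g' x"
      using assms g' by (auto simp: eventually_at_filter smooth_extension_def)
  qed
  then have "g' 0 = g 0"
    using cont[of g'] g' by (auto simp: smooth_extension_def intro: tendsto_unique[OF at_neq_bot])
  then show "g' = g"
    using assms g' unfolding smooth_extension_def fun_eq_iff by metis
qed

text \<open>Since Ln(-1) = i\<pi>, the principal value of the power is exp(-i\<pi>l/2), the inverse
  of i^l.\<close>

lemma minus_one_powr_half: "(- 1 :: complex) powr (- of_int l / 2) * \<i> powi l = 1"
proof -
  have "\<i> = exp (\<i> * of_real pi / 2)"
    using cis_conv_exp[of "pi / 2"] by simp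
  then have "\<i> powi l = exp (\<i> * of_real pi / 2) powi l"
    by (rule arg_cong)
  also have "\<dots> = exp (of_int l * (\<i> * of_real pi / 2))"
    by (rule exp_power_int)
  finally have "\<i> powi l = exp (of_int l * (\<i> * of_real pi / 2))" .
  then show ?thesis
    by (simp add: powr_def flip: exp_add)
qed

text \<open>For \<sigma> = 1 the inversion is evaluated at a negative point and its factor i^l is
  cancelled by (-1)^(-l/2); for \<sigma> = -1 the point is positive and both factors are 1. The
  powers of x cancel as well.\<close>

lemma inversion_at_reflected_inverse:
  assumes sign: "\<sigma> \<in> {1, - 1}" and x: "x > 0"
  shows "of_real x powr (- (2 * lam)) *
    ((- of_real \<sigma>) powr (- of_int l / 2) * inversion lam l f (- \<sigma> * (1 / x))) = f (\<sigma> * x)"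
proof -
  have 1: "of_real \<bar>- \<sigma> * (1 / x)\<bar> powr (- 2 * lam) = of_real x powr (2 * lam)"
    using x sign by (auto simp: powr_def Ln_of_real ln_div simp flip: of_real_divide)
  have 2: "- 1 / (- \<sigma> * (1 / x)) = \<sigma> * x"
    using sign by auto
  have 3: "(- of_real \<sigma>) powr (- of_int l / 2) *
      (if - \<sigma> * (1 / x) > 0 then 1 else \<i> powi l) = 1"
    using sign x minus_one_powr_half[of l] by auto
  have 4: "of_real x powr (- (2 * lam)) * of_real x powr (2 * lam) = (1 :: complex)"
    using x by (simp flip: powr_add)
  have "p * (c * (e * q * y)) = y" if "c * e = 1" "p * q = 1" for p c e q y :: complex
  proof -
    have "p * (c * (e * q * y)) = (c * e) * (p * q) * y" by (simp only: mult_ac)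
    then show ?thesis using that by simp
  qed
  from this[OF 3 4] show ?thesis
    unfolding inversion_def 1 2 .
qed

section \<open>Assembling the continuation and its residues\<close>

theorem theorem2p7:
  fixes lam :: complex and l :: int and f :: "real \<Rightarrow> complex" and \<sigma> :: real
  assumes f: "f \<in> V_smooth lam l"
    and sign: "\<sigma> \<in> {1, - 1}"
  shows "\<exists>F :: complex \<Rightarrow> complex.
    F meromorphic_on UNIV \<and>
    (\<forall>s m. Re s < 2 * Re lam \<and> - real m < Re s \<and> - real m < 2 * Re lam \<and> s \<notin> \<int>\<^sub>\<le>\<^sub>0 \<longrightarrow>
       F s = local_zeta \<sigma> m f s) \<and>
    F analytic_on - (range (\<lambda>k::nat. - of_nat k) \<union> range (\<lambda>k::nat. 2 * lam + of_nat k)) \<and>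
    (\<forall>z. is_pole F z \<longrightarrow>
       (\<exists>k::nat. z = - of_nat k \<or> z = 2 * lam + of_nat k) \<and> - zorder F z \<le> 1) \<and>
    (\<forall>k::nat. \<not> (\<exists>q::nat. lam = - of_nat q / 2 \<and> k \<le> q) \<longrightarrow>
       residue F (- of_nat k) = of_real \<sigma> ^ k / fact k * nderiv k f 0 \<and>
       residue F (2 * lam + of_nat k) =
         - ((- of_real \<sigma>) powr (- of_int l / 2)
            * ((- of_real \<sigma>) ^ k * nderiv k (f_infinity lam l f) 0 / fact k))) \<and>
    (\<forall>q k :: nat. lam = - of_nat q / 2 \<and> k \<le> q \<longrightarrow>
       - of_nat (q - k) = 2 * lam + of_nat k \<and>
       residue F (- of_nat (q - k)) =
         of_real \<sigma> ^ (q - k) / fact (q - k) * nderiv (q - k) f 0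
         - (- of_real \<sigma>) powr (- of_int l / 2)
            * ((- of_real \<sigma>) ^ k * nderiv k (f_infinity lam l f) 0 / fact k))"
proof -
  obtain g where g: "smooth_extension (inversion lam l f) g" and sf: "smooth f"
    using f by (auto simp: V_smooth_def)
  have sg: "smooth g" and fg: "f_infinity lam l f = g"
    using g f_infinity_eqI[OF g] by (auto simp: smooth_extension_def)
  define c where "c = (- of_real \<sigma> :: complex) powr (- of_int l / 2)"
  \<comment> \<open>The factor 1 gives h the shape required by \<open>smooth_scale\<close> and
    \<open>nderiv_scale\<close>.\<close>
  define h where "h = (\<lambda>x. 1 * f (\<sigma> * x))"
  define k where "k = (\<lambda>u. c * g (- \<sigma> * u))"
  have h: "smooth h" and k: "smooth k"
    unfolding h_def k_def by (intro smooth_scale sf sg)+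
  have nh: "nderiv n h x = of_real \<sigma> ^ n * nderiv n f (\<sigma> * x)" for n x
    unfolding h_def by (subst nderiv_scale[OF sf]) simp
  have nk: "nderiv n k 0 = c * ((- of_real \<sigma>) ^ n * nderiv n (f_infinity lam l f) 0)" for n
    unfolding k_def fg by (subst nderiv_scale[OF sg]) simp
  have hk: "h x = of_real x powr (- (2 * lam)) * k (1 / x)" if "x > 0" for x
  proof -
    have "- \<sigma> * (1 / x) \<noteq> 0" using that sign by auto
    then have "g (- \<sigma> * (1 / x)) = inversion lam l f (- \<sigma> * (1 / x))"
      using g unfolding smooth_extension_def by blast
    then show ?thesis
      using inversion_at_reflected_inverse[OF sign that, of lam l f]
      unfolding h_def k_def c_def by simp
  qed
  define F where "F = (\<lambda>s. mellin_cont h s + mellin_cont k (2 * lam - s))"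
  \<comment> \<open>The pole coefficient of \<open>mellin_cont h\<close> as a total function of z,
    equal to 0 off the nonpositive integers. A single residue formula for F then holds at every
    point, including coinciding poles.\<close>
  define R where "R = (\<lambda>h z. if z \<in> \<int>\<^sub>\<le>\<^sub>0 then nderiv (nat \<lfloor>- Re z\<rfloor>) h 0 / fact (nat \<lfloor>- Re z\<rfloor>) else 0 :: complex)"
  have R_nat: "R h (- of_nat n) = nderiv n h 0 / fact n" for h and n :: nat
    by (simp add: R_def nonpos_Int_iff_nat)
  have "at_most_simple_pole (mellin_cont h) z (R h z)" if "smooth h" for h z
  proof (cases "z \<in> \<int>\<^sub>\<le>\<^sub>0")
    case True
    then show ?thesis
      using mellin_cont_pole[OF that] by (auto simp: nonpos_Int_iff_nat R_nat)
  next
    case False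
    then show ?thesis
      using at_most_simple_pole_analytic mellin_cont_analytic[OF that] by (simp add: R_def)
  qed
  then have pole: "at_most_simple_pole F z (R h z - R k (2 * lam - z))" for z
    unfolding F_def
    using at_most_simple_pole_add[OF _ at_most_simple_pole_reflect[of "mellin_cont k"]] h k
    by (metis diff_conv_add_uminus)
  have res: "residue F z = R h z - R k (2 * lam - z)" for z
    by (rule at_most_simple_pole_residue[OF pole])
  have ana: "F analytic_on {z}" if "z \<notin> \<int>\<^sub>\<le>\<^sub>0" "2 * lam - z \<notin> \<int>\<^sub>\<le>\<^sub>0" for z
  proof -
    have "(mellin_cont k \<circ> (\<lambda>s. 2 * lam - s)) analytic_on {z}"
      by (rule analytic_on_compose) (use mellin_cont_analytic[OF k that(2)] in \<open>auto intro!: analytic_intros\<close>)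
    then show ?thesis
      unfolding F_def using mellin_cont_analytic[OF h that(1)]
      by (intro analytic_intros) (auto simp: o_def)
  qed
  have lam_iff: "2 * lam - z \<in> \<int>\<^sub>\<le>\<^sub>0 \<longleftrightarrow> (\<exists>n::nat. z = 2 * lam + of_nat n)" for z
    by (auto simp: nonpos_Int_iff_nat algebra_simps)
  show ?thesis
  proof (intro exI[of _ F] conjI allI impI)
    show "F meromorphic_on UNIV"
      using at_most_simple_pole_meromorphic[OF pole] meromorphic_on_meromorphic_at by blast
  next
    fix s m
    assume s: "Re s < 2 * Re lam \<and> - real m < Re s \<and> - real m < 2 * Re lam \<and> s \<notin> \<int>\<^sub>\<le>\<^sub>0"
    \<comment> \<open>The chain-rule factor \<sigma>^m in the derivatives of h accounts for the
      difference between (-\<sigma>)^m in \<open>local_zeta\<close> and (-1)^m.\<close>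
    have "(LINT x:{0<..}|lborel. of_real x powr (s + of_nat m - 1) * nderiv m h x) =
      of_real \<sigma> ^ m * (LINT x:{0<..}|lborel. of_real x powr (s + of_nat m - 1) * nderiv m f (\<sigma> * x))"
      unfolding nh set_integral_mult_right[symmetric] by (simp only: mult_ac)
    then have "local_zeta \<sigma> m f s = (- 1) ^ m / pochhammer s m *
      (LINT x:{0<..}|lborel. of_real x powr (s + of_nat m - 1) * nderiv m h x)"
      unfolding local_zeta_def by (simp add: power_minus[of "of_real \<sigma>"])
    also have "\<dots> = F s"
      unfolding F_def by (rule mellin_halfline_eq_cont[OF h k hk]) (use s in auto)
    finally show "F s = local_zeta \<sigma> m f s" by simp
  next
    show "F analytic_on - (range (\<lambda>k::nat. - of_nat k) \<union> range (\<lambda>k::nat. 2 * lam + of_nat k))"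
    proof (subst analytic_on_analytic_at, intro ballI)
      fix z
      assume "z \<in> - (range (\<lambda>k::nat. - of_nat k) \<union> range (\<lambda>k::nat. 2 * lam + of_nat k))"
      then have "z \<notin> \<int>\<^sub>\<le>\<^sub>0" "\<not> (\<exists>n::nat. z = 2 * lam + of_nat n)"
        by (auto simp: nonpos_Int_iff_nat)
      then show "F analytic_on {z}"
        using ana lam_iff by blast
    qed
  next
    fix z assume z: "is_pole F z"
    show "\<exists>k::nat. z = - of_nat k \<or> z = 2 * lam + of_nat k"
    proof (rule ccontr)
      assume "\<not> ?thesis"
      then have "z \<notin> \<int>\<^sub>\<le>\<^sub>0" "\<not> (\<exists>n::nat. z = 2 * lam + of_nat n)"
        by (auto simp: nonpos_Int_iff_nat)
      then have "F analytic_on {z}"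
        using ana lam_iff by blast
      then show False
        using z analytic_at_imp_no_pole by blast
    qed
    show "- zorder F z \<le> 1"
      using at_most_simple_pole_zorder[OF pole z] by simp
  next
    fix n :: nat
    assume n: "\<not> (\<exists>q::nat. lam = - of_nat q / 2 \<and> n \<le> q)"
    \<comment> \<open>A coincidence would put the index into the exceptional case with q = n + j.
      Disjointness removes the k-term at -n, because 2\<lambda> - (-n) = 2\<lambda> + n, and the
      h-term at 2\<lambda> + n.\<close>
    have disj: "2 * lam + of_nat n \<noteq> - of_nat j" for j :: nat
    proof
      assume "2 * lam + of_nat n = - of_nat j"
      then have "lam = - of_nat (n + j) / 2" by (simp add: field_simps)
      then show False using n le_add1 by blast
    qed
    then have 0: "R h (2 * lam + of_nat n) = 0" "R k (2 * lam + of_nat n) = 0"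
      by (auto simp: R_def nonpos_Int_iff_nat)
    show "residue F (- of_nat n) = of_real \<sigma> ^ n / fact n * nderiv n f 0"
      unfolding res R_nat using 0 by (simp add: nh)
    show "residue F (2 * lam + of_nat n) = - ((- of_real \<sigma>) powr (- of_int l / 2)
            * ((- of_real \<sigma>) ^ n * nderiv n (f_infinity lam l f) 0 / fact n))"
      unfolding res using 0 R_nat[of k n] nk[of n] by (simp add: c_def)
  next
    fix q n :: nat
    assume qn: "lam = - of_nat q / 2 \<and> n \<le> q"
    then show eq: "- of_nat (q - n) = 2 * lam + of_nat n"
      by (simp add: of_nat_diff)
    \<comment> \<open>Both terms contribute here: read as -(q - n) the point gives the
      h-coefficient, read as 2\<lambda> + n it gives the k-coefficient at -n.\<close>
    have "R k (2 * lam - (2 * lam + of_nat n)) =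
        c * ((- of_real \<sigma>) ^ n * nderiv n (f_infinity lam l f) 0) / fact n"
      using R_nat[of k n] nk[of n] by simp
    then show "residue F (- of_nat (q - n)) =
         of_real \<sigma> ^ (q - n) / fact (q - n) * nderiv (q - n) f 0
         - (- of_real \<sigma>) powr (- of_int l / 2)
            * ((- of_real \<sigma>) ^ n * nderiv n (f_infinity lam l f) 0 / fact n)"
      unfolding res R_nat unfolding eq by (simp add: nh c_def)
  qed
qed

end
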